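(* Let $m$ be a positive integer and let $C^*(\mathbb Z_m)$ denote the operator system of $m\times m$ complex circulant matrices. Then, for every $n\ge 2$, $$(C(S^1)^{(n)})_+\otimes_{\rm sep}C^*(\mathbb Z_m)_+=(C(S^1)^{(n)})_+\otimes_{{\rm sep}^*}C^*(\mathbb Z_m)_+ .$$
   Context: $C(S^1)^{(n)}$ is the operator system of all $n\times n$ complex Toeplitz matrices, an operator subsystem of $\mathcal M_n(\mathbb C)$; the circulant matrices form a unital abelian C$^*$-subalgebra of $\mathcal M_m(\mathbb C)$. Base cones consist of the positive semidefinite matrices in the respective spaces. For finite-dimensional operator systems $\mathcal R,\mathcal T$: $\mathcal R_+\otimes_{\rm sep}\mathcal T_+=\{\sum_{j=1}^k a_j\otimes b_j : k\in\mathbb N,\ a_j\in\mathcal R_+,\ b_j\in\mathcal T_+\}$, and $\mathcal R_+\otimes_{{\rm sep}^*}\mathcal T_+=\{x\in(\mathcal R\otimes_{\mathbb C}\mathcal T)_{\rm sa} : (\phi\otimes\psi)(x)\ge 0 \text{ for all positive linear functionals }\phi\text{ on }\mathcal R\text{ and }\psi\text{ on }\mathcal T\}$. *)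

theory Defs
  imports "Jordan_Normal_Form.Schur_Decomposition"
begin

definition operator_system :: "nat \<Rightarrow> complex mat set \<Rightarrow> bool" where
  "operator_system d R \<longleftrightarrow> R \<subseteq> carrier_mat d d \<and> 1\<^sub>m d \<in> R
     \<and> (\<forall>A\<in>R. \<forall>B\<in>R. A + B \<in> R) \<and> (\<forall>c. \<forall>A\<in>R. c \<cdot>\<^sub>m A \<in> R) \<and> (\<forall>A\<in>R. mat_adjoint A \<in> R)"

definition toeplitz_system :: "nat \<Rightarrow> complex mat set" where
  "toeplitz_system n = {A \<in> carrier_mat n n.
     \<exists>t :: int \<Rightarrow> complex. \<forall>i<n. \<forall>j<n. A $$ (i, j) = t (int i - int j)}"

definition circulant_system :: "nat \<Rightarrow> complex mat set" where
  "circulant_system m = {A \<in> carrier_mat m m.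
     \<exists>c :: int \<Rightarrow> complex. \<forall>i<m. \<forall>j<m. A $$ (i, j) = c ((int i - int j) mod int m)}"

(* The order on complex is the one of Complex_Order: 0 \<le> z says that z is real and nonnegative,
   so the condition below already forces A to be Hermitian. *)
definition psd :: "nat \<Rightarrow> complex mat \<Rightarrow> bool" where
  "psd d A \<longleftrightarrow> A \<in> carrier_mat d d \<and> (\<forall>v\<in>carrier_vec d. 0 \<le> (A *\<^sub>v v) \<bullet>c v)"

definition pos_cone :: "nat \<Rightarrow> complex mat set \<Rightarrow> complex mat set" where
  "pos_cone d R = {A \<in> R. psd d A}"

definition linear_functional :: "complex mat set \<Rightarrow> (complex mat \<Rightarrow> complex) \<Rightarrow> bool" where
  "linear_functional R \<phi> \<longleftrightarrow>
     (\<forall>A\<in>R. \<forall>B\<in>R. \<phi> (A + B) = \<phi> A + \<phi> B) \<and> (\<forall>c. \<forall>A\<in>R. \<phi> (c \<cdot>\<^sub>m A) = c * \<phi> A)"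

definition positive_functional :: "nat \<Rightarrow> complex mat set \<Rightarrow> (complex mat \<Rightarrow> complex) \<Rightarrow> bool" where
  "positive_functional d R \<phi> \<longleftrightarrow> linear_functional R \<phi> \<and> (\<forall>A\<in>pos_cone d R. 0 \<le> \<phi> A)"

(* Tensor products are realised by the Kronecker product inside the (n*m) x (n*m) matrices. *)
definition kron :: "complex mat \<Rightarrow> complex mat \<Rightarrow> complex mat" where
  "kron A B = mat (dim_row A * dim_row B) (dim_col A * dim_col B)
     (\<lambda>(i, j). A $$ (i div dim_row B, j div dim_col B) * B $$ (i mod dim_row B, j mod dim_col B))"

definition tensor_sum ::
  "nat \<Rightarrow> nat \<Rightarrow> nat \<Rightarrow> (nat \<Rightarrow> complex mat) \<Rightarrow> (nat \<Rightarrow> complex mat) \<Rightarrow> complex mat" where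
  "tensor_sum n m k a b = finsum (module_mat TYPE(complex) (n * m) (n * m)) (\<lambda>j. kron (a j) (b j)) {..<k}"

definition tensor_space ::
  "nat \<Rightarrow> complex mat set \<Rightarrow> nat \<Rightarrow> complex mat set \<Rightarrow> complex mat set" where
  "tensor_space n R m T = {tensor_sum n m k a b | k a b. \<forall>j<k. a j \<in> R \<and> b j \<in> T}"

(* The functional \<phi> \<otimes> \<psi> on R \<otimes> T; see tensor_functional_eq for the independence of the
   chosen representation of x. *)
definition tensor_functional ::
  "nat \<Rightarrow> complex mat set \<Rightarrow> nat \<Rightarrow> complex mat set
   \<Rightarrow> (complex mat \<Rightarrow> complex) \<Rightarrow> (complex mat \<Rightarrow> complex) \<Rightarrow> complex mat \<Rightarrow> complex" where
  "tensor_functional n R m T \<phi> \<psi> x = (THE z. \<exists>k a b. (\<forall>j<k. a j \<in> R \<and> b j \<in> T)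
     \<and> x = tensor_sum n m k a b \<and> z = (\<Sum>j<k. \<phi> (a j) * \<psi> (b j)))"

definition sep_cone ::
  "nat \<Rightarrow> complex mat set \<Rightarrow> nat \<Rightarrow> complex mat set \<Rightarrow> complex mat set" where
  "sep_cone n R m T =
     {tensor_sum n m k a b | k a b. \<forall>j<k. a j \<in> pos_cone n R \<and> b j \<in> pos_cone m T}"

definition sep_dual_cone ::
  "nat \<Rightarrow> complex mat set \<Rightarrow> nat \<Rightarrow> complex mat set \<Rightarrow> complex mat set" where
  "sep_dual_cone n R m T = {x \<in> tensor_space n R m T. mat_adjoint x = x
     \<and> (\<forall>\<phi> \<psi>. positive_functional n R \<phi> \<longrightarrow> positive_functional m T \<psi>
           \<longrightarrow> 0 \<le> tensor_functional n R m T \<phi> \<psi> x)}"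

lemma mat_adjoint_index:
  assumes "A \<in> carrier_mat n m" "i < m" "j < n"
  shows "mat_adjoint A $$ (i, j) = cnj (A $$ (j, i))"
  using assms by (auto simp: mat_adjoint_def mat_of_rows_def)

lemma mat_adjoint_carrier:
  fixes A :: "complex mat"
  assumes "A \<in> carrier_mat n m"
  shows "mat_adjoint A \<in> carrier_mat m n"
  using assms by (auto simp: mat_adjoint_def)

lemma operator_system_toeplitz: "operator_system n (toeplitz_system n)"
  unfolding operator_system_def
proof (intro conjI ballI allI)
  show "toeplitz_system n \<subseteq> carrier_mat n n" by (auto simp: toeplitz_system_def)
  show "1\<^sub>m n \<in> toeplitz_system n"
    by (auto simp: toeplitz_system_def intro!: exI[of _ "\<lambda>k. if k = 0 then 1 else 0"])
next
  fix A B assume "A \<in> toeplitz_system n" "B \<in> toeplitz_system n"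
  then obtain s t where "A \<in> carrier_mat n n" "B \<in> carrier_mat n n"
    "\<forall>i<n. \<forall>j<n. A $$ (i, j) = s (int i - int j)" "\<forall>i<n. \<forall>j<n. B $$ (i, j) = t (int i - int j)"
    by (auto simp: toeplitz_system_def)
  then show "A + B \<in> toeplitz_system n"
    by (auto simp: toeplitz_system_def intro!: exI[of _ "\<lambda>k. s k + t k"])
next
  fix c A assume "A \<in> toeplitz_system n"
  then obtain s where "A \<in> carrier_mat n n" "\<forall>i<n. \<forall>j<n. A $$ (i, j) = s (int i - int j)"
    by (auto simp: toeplitz_system_def)
  then show "c \<cdot>\<^sub>m A \<in> toeplitz_system n"
    by (auto simp: toeplitz_system_def intro!: exI[of _ "\<lambda>k. c * s k"])
next
  fix A assume "A \<in> toeplitz_system n"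
  then obtain s where "A \<in> carrier_mat n n" "\<forall>i<n. \<forall>j<n. A $$ (i, j) = s (int i - int j)"
    by (auto simp: toeplitz_system_def)
  then show "mat_adjoint A \<in> toeplitz_system n"
    by (auto simp: toeplitz_system_def mat_adjoint_carrier mat_adjoint_index
        intro!: exI[of _ "\<lambda>k. cnj (s (- k))"])
qed

lemma operator_system_circulant: "operator_system m (circulant_system m)"
  unfolding operator_system_def
proof (intro conjI ballI allI)
  show "circulant_system m \<subseteq> carrier_mat m m" by (auto simp: circulant_system_def)
  have "i = j" if "i < m" "j < m" "(int i - int j) mod int m = 0" for i j
  proof -
    have "int i mod int m = int j mod int m" using that(3) by (simp add: mod_eq_dvd_iff mod_eq_0_iff_dvd)
    with that show ?thesis by simp
  qed
  then show "1\<^sub>m m \<in> circulant_system m"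
    by (auto simp: circulant_system_def intro!: exI[of _ "\<lambda>k. if k = 0 then 1 else 0"])
next
  fix A B assume "A \<in> circulant_system m" "B \<in> circulant_system m"
  then obtain s t where "A \<in> carrier_mat m m" "B \<in> carrier_mat m m"
    "\<forall>i<m. \<forall>j<m. A $$ (i, j) = s ((int i - int j) mod int m)"
    "\<forall>i<m. \<forall>j<m. B $$ (i, j) = t ((int i - int j) mod int m)"
    by (auto simp: circulant_system_def)
  then show "A + B \<in> circulant_system m"
    by (auto simp: circulant_system_def intro!: exI[of _ "\<lambda>k. s k + t k"])
next
  fix c A assume "A \<in> circulant_system m"
  then obtain s where "A \<in> carrier_mat m m"
    "\<forall>i<m. \<forall>j<m. A $$ (i, j) = s ((int i - int j) mod int m)"
    by (auto simp: circulant_system_def)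
  then show "c \<cdot>\<^sub>m A \<in> circulant_system m"
    by (auto simp: circulant_system_def intro!: exI[of _ "\<lambda>k. c * s k"])
next
  fix A assume "A \<in> circulant_system m"
  then obtain s where s: "A \<in> carrier_mat m m"
    "\<forall>i<m. \<forall>j<m. A $$ (i, j) = s ((int i - int j) mod int m)"
    by (auto simp: circulant_system_def)
  have "(- ((int i - int j) mod int m)) mod int m = (int j - int i) mod int m" for i j
    by (metis minus_diff_eq mod_minus_eq)
  with s show "mat_adjoint A \<in> circulant_system m"
    by (auto simp: circulant_system_def mat_adjoint_carrier mat_adjoint_index
        intro!: exI[of _ "\<lambda>k. cnj (s ((- k) mod int m))"])
qed

lemma kron_carrier:
  "A \<in> carrier_mat n n \<Longrightarrow> B \<in> carrier_mat m m \<Longrightarrow> kron A B \<in> carrier_mat (n * m) (n * m)"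
  by (auto simp: kron_def)

lemma kron_index:
  assumes "A \<in> carrier_mat n n" "B \<in> carrier_mat m m" "i < n" "j < n" "k < m" "l < m"
  shows "kron A B $$ (i * m + k, j * m + l) = A $$ (i, j) * B $$ (k, l)"
proof -
  have less: "p * m + q < n * m" if "p < n" "q < m" for p q
  proof -
    have "p * m + q < Suc p * m" using that by simp
    also have "\<dots> \<le> n * m" using that by (intro mult_le_mono1) simp
    finally show ?thesis .
  qed
  show ?thesis using assms less[of i k] less[of j l] by (auto simp: kron_def)
qed

lemma finsum_mat_index:
  assumes "\<And>j. j < k \<Longrightarrow> f j \<in> carrier_mat d d"
  shows "finsum (module_mat TYPE(complex) d d) f {..<k} \<in> carrier_mat d d"
    and "p < d \<Longrightarrow> q < d \<Longrightarrow>
      finsum (module_mat TYPE(complex) d d) f {..<(k::nat)} $$ (p, q) = (\<Sum>j<k. f j $$ (p, q))"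
proof -
  interpret V: abelian_group "module_mat TYPE(complex) d d" by (rule abelian_group_mat)
  have "finsum (module_mat TYPE(complex) d d) f {..<k} \<in> carrier_mat d d \<and>
     (p < d \<longrightarrow> q < d \<longrightarrow> finsum (module_mat TYPE(complex) d d) f {..<k} $$ (p, q) = (\<Sum>j<k. f j $$ (p, q)))"
    using assms
  proof (induction k)
    case 0
    then show ?case by (simp add: module_mat_simps)
  next
    case (Suc k)
    have "f \<in> {..<k} \<rightarrow> carrier (module_mat TYPE(complex) d d)" "f k \<in> carrier_mat d d"
      using Suc.prems by (auto simp: module_mat_simps)
    then show ?case using Suc
      by (auto simp: module_mat_simps lessThan_Suc)
  qed
  then show "finsum (module_mat TYPE(complex) d d) f {..<k} \<in> carrier_mat d d"
    and "p < d \<Longrightarrow> q < d \<Longrightarrow>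
      finsum (module_mat TYPE(complex) d d) f {..<(k::nat)} $$ (p, q) = (\<Sum>j<k. f j $$ (p, q))"
    by auto
qed

lemma operator_system_zero: "operator_system d R \<Longrightarrow> 0\<^sub>m d d \<in> R"
proof -
  assume "operator_system d R"
  then have "0 \<cdot>\<^sub>m 1\<^sub>m d \<in> R" by (auto simp: operator_system_def)
  moreover have "0 \<cdot>\<^sub>m 1\<^sub>m d = (0\<^sub>m d d :: complex mat)" by (rule eq_matI) auto
  ultimately show ?thesis by simp
qed

lemma functional_sum:
  assumes R: "operator_system d R" and \<phi>: "linear_functional R \<phi>" and "\<And>j. j < k \<Longrightarrow> a j \<in> R"
  shows "mat d d (\<lambda>pq. \<Sum>j<k. c j * a j $$ pq) \<in> R
    \<and> \<phi> (mat d d (\<lambda>pq. \<Sum>j<(k::nat). c j * a j $$ pq)) = (\<Sum>j<k. c j * \<phi> (a j))"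
  using assms(3)
proof (induction k)
  case 0
  have "mat d d (\<lambda>pq. 0) = (0\<^sub>m d d :: complex mat)" by (rule eq_matI) auto
  moreover have "0\<^sub>m d d \<in> R" by (rule operator_system_zero[OF R])
  moreover from this have "\<phi> (0 \<cdot>\<^sub>m 0\<^sub>m d d) = 0 * \<phi> (0\<^sub>m d d)"
    using \<phi> unfolding linear_functional_def by blast
  ultimately show ?case by simp
next
  case (Suc k)
  let ?M = "mat d d (\<lambda>pq. \<Sum>j<k. c j * a j $$ pq)"
  have a: "a k \<in> R" "a k \<in> carrier_mat d d" using Suc.prems[of k] R by (auto simp: operator_system_def)
  have c: "c k \<cdot>\<^sub>m a k \<in> R" "\<phi> (c k \<cdot>\<^sub>m a k) = c k * \<phi> (a k)"
    using a R \<phi> by (auto simp: operator_system_def linear_functional_def)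
  have IH: "?M \<in> R" "\<phi> ?M = (\<Sum>j<k. c j * \<phi> (a j))" using Suc by auto
  have "mat d d (\<lambda>pq. \<Sum>j<Suc k. c j * a j $$ pq) = ?M + c k \<cdot>\<^sub>m a k"
    using a by (intro eq_matI) auto
  moreover have "?M + c k \<cdot>\<^sub>m a k \<in> R" "\<phi> (?M + c k \<cdot>\<^sub>m a k) = \<phi> ?M + \<phi> (c k \<cdot>\<^sub>m a k)"
    using IH c R \<phi> by (auto simp: operator_system_def linear_functional_def)
  ultimately show ?case using IH c by simp
qed

lemma tensor_sum_unique:
  assumes R: "operator_system n R" and T: "operator_system m T"
    and \<phi>: "linear_functional R \<phi>" and \<psi>: "linear_functional T \<psi>"
    and ab: "\<And>j. j < k \<Longrightarrow> a j \<in> R \<and> b j \<in> T" and ab': "\<And>j. j < k' \<Longrightarrow> a' j \<in> R \<and> b' j \<in> T"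
    and eq: "tensor_sum n m k a b = tensor_sum n m k' a' b'"
  shows "(\<Sum>j<k. \<phi> (a j) * \<psi> (b j)) = (\<Sum>j<k'. \<phi> (a' j) * \<psi> (b' j))"
proof -
  have car: "A \<in> R \<Longrightarrow> A \<in> carrier_mat n n" "B \<in> T \<Longrightarrow> B \<in> carrier_mat m m" for A B
    using R T by (auto simp: operator_system_def)
  have ent: "tensor_sum n m k a b $$ (p * m + r, q * m + s) = (\<Sum>j<k. a j $$ (p, q) * b j $$ (r, s))"
    if "\<And>j. j < k \<Longrightarrow> a j \<in> R \<and> b j \<in> T" "p < n" "q < n" "r < m" "s < m" for k a b p q r s
  proof -
    have less: "p * m + q < n * m" if "p < n" "q < m" for p q
    proof -
      have "p * m + q < Suc p * m" using that by simp
      also have "\<dots> \<le> n * m" using that by (intro mult_le_mono1) simp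
      finally show ?thesis .
    qed
    have "tensor_sum n m k a b $$ (p * m + r, q * m + s)
        = (\<Sum>j<k. kron (a j) (b j) $$ (p * m + r, q * m + s))"
      unfolding tensor_sum_def using that car less
      by (intro finsum_mat_index(2)) (auto intro!: kron_carrier)
    also have "\<dots> = (\<Sum>j<k. a j $$ (p, q) * b j $$ (r, s))"
      using that car by (intro sum.cong kron_index) auto
    finally show ?thesis .
  qed
  have 1: "(\<Sum>j<k. a j $$ (p, q) * \<psi> (b j)) = (\<Sum>j<k'. a' j $$ (p, q) * \<psi> (b' j))"
    if "p < n" "q < n" for p q
  proof -
    have "mat m m (\<lambda>rs. \<Sum>j<k. a j $$ (p, q) * b j $$ rs) = mat m m (\<lambda>rs. \<Sum>j<k'. a' j $$ (p, q) * b' j $$ rs)"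
      using ent[of k a b, OF ab] ent[of k' a' b', OF ab'] eq that by (intro eq_matI) auto
    then show ?thesis
      using functional_sum[OF T \<psi>, of k b "\<lambda>j. a j $$ (p, q)"]
        functional_sum[OF T \<psi>, of k' b' "\<lambda>j. a' j $$ (p, q)"] ab ab' by auto
  qed
  have "mat n n (\<lambda>pq. \<Sum>j<k. \<psi> (b j) * a j $$ pq) = mat n n (\<lambda>pq. \<Sum>j<k'. \<psi> (b' j) * a' j $$ pq)"
    using 1 by (intro eq_matI) (auto simp: mult.commute)
  then have "(\<Sum>j<k. \<psi> (b j) * \<phi> (a j)) = (\<Sum>j<k'. \<psi> (b' j) * \<phi> (a' j))"
    using functional_sum[OF R \<phi>, of k a "\<lambda>j. \<psi> (b j)"]
      functional_sum[OF R \<phi>, of k' a' "\<lambda>j. \<psi> (b' j)"] ab ab' by auto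
  then show ?thesis by (simp add: mult.commute)
qed

lemma tensor_functional_eq:
  assumes "operator_system n R" "operator_system m T"
    and "linear_functional R \<phi>" "linear_functional T \<psi>"
    and "\<And>j. j < k \<Longrightarrow> a j \<in> R \<and> b j \<in> T"
  shows "tensor_functional n R m T \<phi> \<psi> (tensor_sum n m k a b) = (\<Sum>j<k. \<phi> (a j) * \<psi> (b j))"
  unfolding tensor_functional_def
proof (rule the_equality)
  show "\<exists>k' a' b'. (\<forall>j<k'. a' j \<in> R \<and> b' j \<in> T) \<and> tensor_sum n m k a b = tensor_sum n m k' a' b'
      \<and> (\<Sum>j<k. \<phi> (a j) * \<psi> (b j)) = (\<Sum>j<k'. \<phi> (a' j) * \<psi> (b' j))"
    using assms(5) by blast
next
  fix z assume "\<exists>k' a' b'. (\<forall>j<k'. a' j \<in> R \<and> b' j \<in> T)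
      \<and> tensor_sum n m k a b = tensor_sum n m k' a' b' \<and> z = (\<Sum>j<k'. \<phi> (a' j) * \<psi> (b' j))"
  then obtain k' a' b' where "\<And>j. j < k' \<Longrightarrow> a' j \<in> R \<and> b' j \<in> T"
    "tensor_sum n m k a b = tensor_sum n m k' a' b'" "z = (\<Sum>j<k'. \<phi> (a' j) * \<psi> (b' j))"
    by blast
  then show "z = (\<Sum>j<k. \<phi> (a j) * \<psi> (b j))"
    using tensor_sum_unique[OF assms(1-4), of k a b k' a' b'] assms(5) by simp
qed

end

theory Submission
  imports Defs
begin

text \<open>
  The discrete Fourier transform diagonalises the circulant matrices: every circulant \<open>B\<close> is
  \<open>\<Sum>l<m. \<psi> l B \<cdot> P l\<close>, where the \<open>P l\<close> are the rank-one Fourier projections and the \<open>\<psi> l\<close> are the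
  corresponding vector states. Hence an element \<open>x\<close> of the tensor product can be rewritten as
  \<open>\<Sum>l<m. A l \<otimes> P l\<close> with \<open>\<phi> (A l) = (\<phi> \<otimes> \<psi> l) x\<close> for every functional \<open>\<phi>\<close>. If \<open>x\<close> lies in the dual
  cone, vector states \<open>\<phi>\<close> show that each \<open>A l\<close> is positive semidefinite, so this is already a
  separable decomposition.
\<close>

section \<open>Positive semidefinite matrices and vector functionals\<close>

text \<open>The unnormalised vector state of \<open>v\<close>. Leaving \<open>v\<close> arbitrary
  makes it serve both as a test for positive semidefiniteness and, at \<open>fourier_vec\<close>, as
  the source of the Fourier coefficients.\<close>

definition vector_functional :: "complex vec \<Rightarrow> complex mat \<Rightarrow> complex" where
  "vector_functional v A = (A *\<^sub>v v) \<bullet>c v"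

lemma vector_functional_sum:
  assumes "A \<in> carrier_mat d d" "v \<in> carrier_vec d"
  shows "vector_functional v A = (\<Sum>i<d. \<Sum>j<d. A $$ (i, j) * v $ j * cnj (v $ i))"
  using assms
  by (auto simp: vector_functional_def scalar_prod_def sum_distrib_right lessThan_atLeast0
      intro!: sum.cong)

lemma linear_vector_functional:
  assumes "R \<subseteq> carrier_mat d d" "v \<in> carrier_vec d"
  shows "linear_functional R (vector_functional v)"
  unfolding linear_functional_def
proof (intro conjI ballI allI)
  fix A B assume "A \<in> R" "B \<in> R"
  then have "A \<in> carrier_mat d d" "B \<in> carrier_mat d d" using assms by auto
  then show "vector_functional v (A + B) = vector_functional v A + vector_functional v B"
    using assms by (simp add: vector_functional_sum[of _ d] sum.distrib algebra_simps)
next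
  fix c A assume "A \<in> R"
  then have "A \<in> carrier_mat d d" using assms by auto
  then show "vector_functional v (c \<cdot>\<^sub>m A) = c * vector_functional v A"
    using assms by (simp add: vector_functional_sum[of _ d] sum_distrib_left mult.assoc)
qed

lemma positive_vector_functional:
  assumes "R \<subseteq> carrier_mat d d" "v \<in> carrier_vec d"
  shows "positive_functional d R (vector_functional v)"
  using linear_vector_functional[OF assms] assms(2)
  by (auto simp: positive_functional_def pos_cone_def psd_def vector_functional_def)

lemma psdI:
  assumes "A \<in> carrier_mat d d" "\<And>v. v \<in> carrier_vec d \<Longrightarrow> 0 \<le> vector_functional v A"
  shows "psd d A"
  using assms by (simp add: psd_def vector_functional_def)

text \<open>Polarisation: the quadratic form is real at every vector \<open>u i + c u j\<close>,
  which ties the two off-diagonal entries together. This supplies the self-adjointness clause of the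
  dual cone.\<close>

lemma psd_hermitian:
  assumes "psd d A" "i < d" "j < d"
  shows "A $$ (j, i) = cnj (A $$ (i, j))"
proof -
  have A: "A \<in> carrier_mat d d" and pos: "\<And>v. v \<in> carrier_vec d \<Longrightarrow> 0 \<le> (A *\<^sub>v v) \<bullet>c v"
    using assms(1) by (auto simp: psd_def)
  have unit: "(A *\<^sub>v unit_vec d q) \<bullet>c unit_vec d p = A $$ (p, q)" if "p < d" "q < d" for p q
  proof -
    have "conjugate (unit_vec d p) = (unit_vec d p :: complex vec)"
      by (rule eq_vecI) (auto simp: unit_vec_def)
    then show ?thesis using A that by (simp add: scalar_prod_right_unit)
  qed
  define u where "u p = (unit_vec d p :: complex vec)" for p
  have u: "u p \<in> carrier_vec d" for p by (simp add: u_def)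
  have expand: "(A *\<^sub>v (u i + c \<cdot>\<^sub>v u j)) \<bullet>c (u i + c \<cdot>\<^sub>v u j)
      = A $$ (i, i) + c * A $$ (i, j) + cnj c * A $$ (j, i) + c * cnj c * A $$ (j, j)" for c
  proof -
    have Au: "A *\<^sub>v u p \<in> carrier_vec d" for p using A u by simp
    have "(A *\<^sub>v (u i + c \<cdot>\<^sub>v u j)) \<bullet>c (u i + c \<cdot>\<^sub>v u j)
        = (A *\<^sub>v u i + c \<cdot>\<^sub>v (A *\<^sub>v u j)) \<bullet> (conjugate (u i) + cnj c \<cdot>\<^sub>v conjugate (u j))"
      using A u by (simp add: mult_add_distrib_mat_vec[of _ d d] mult_mat_vec[of _ d d]
          conjugate_add_vec[of _ d] conjugate_smult_vec)
    also have "\<dots> = (A *\<^sub>v u i) \<bullet>c u i + c * ((A *\<^sub>v u j) \<bullet>c u i)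
        + cnj c * ((A *\<^sub>v u i) \<bullet>c u j) + c * cnj c * ((A *\<^sub>v u j) \<bullet>c u j)"
      using u Au
      by (simp add: add_scalar_prod_distrib[of _ d] scalar_prod_add_distrib[of _ d]
          smult_scalar_prod_distrib[of _ d] scalar_prod_smult_distrib[of _ d] algebra_simps)
    finally show ?thesis using unit assms by (simp add: u_def)
  qed
  have im: "Im (A $$ (i, i) + c * A $$ (i, j) + cnj c * A $$ (j, i) + c * cnj c * A $$ (j, j)) = 0" for c
    using pos[of "u i + c \<cdot>\<^sub>v u j"] u unfolding expand by (simp add: less_eq_complex_def)
  have diag: "Im (A $$ (p, p)) = 0" if "p < d" for p
    using pos[of "unit_vec d p"] unit[of p p] that by (simp add: less_eq_complex_def)
  \<comment> \<open>Once the diagonal is real, \<open>c = 1\<close> makes the imaginary parts of the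
    two entries opposite, and \<open>c = \<i>\<close> makes their real parts equal.\<close>
  show ?thesis
    using im[of 1] im[of \<i>] diag[of i] diag[of j] assms by (simp add: complex_eq_iff)
qed

section \<open>Tensor sums\<close>

lemma tensor_sum_carrier:
  assumes "\<And>j. j < k \<Longrightarrow> a j \<in> carrier_mat n n \<and> b j \<in> carrier_mat m m"
  shows "tensor_sum n m k a b \<in> carrier_mat (n * m) (n * m)"
  unfolding tensor_sum_def using assms by (intro finsum_mat_index(1)) (auto intro: kron_carrier)

text \<open>Indexing by flat positions, rather than by pairs as in \<open>kron_index\<close>, fits
  the goals that \<open>eq_matI\<close> produces.\<close>

lemma tensor_sum_index:
  assumes "\<And>j. j < k \<Longrightarrow> a j \<in> carrier_mat n n \<and> b j \<in> carrier_mat m m"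
    and "p < n * m" "q < n * m"
  shows "tensor_sum n m k a b $$ (p, q)
    = (\<Sum>j<k. a j $$ (p div m, q div m) * b j $$ (p mod m, q mod m))"
proof -
  have "tensor_sum n m k a b $$ (p, q) = (\<Sum>j<k. kron (a j) (b j) $$ (p, q))"
    unfolding tensor_sum_def using assms
    by (intro finsum_mat_index(2)) (auto intro: kron_carrier)
  also have "\<dots> = (\<Sum>j<k. a j $$ (p div m, q div m) * b j $$ (p mod m, q mod m))"
  proof (intro sum.cong refl)
    fix j assume "j \<in> {..<k}"
    then have "a j \<in> carrier_mat n n" "b j \<in> carrier_mat m m" using assms(1) by auto
    then show "kron (a j) (b j) $$ (p, q) = a j $$ (p div m, q div m) * b j $$ (p mod m, q mod m)"
      using assms(2,3) by (auto simp: kron_def)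
  qed
  finally show ?thesis .
qed

text \<open>The easy inclusion, for any two operator systems: on a separable element a product
  functional is a sum of products of nonnegative numbers.\<close>

lemma sep_cone_subset_sep_dual_cone:
  assumes R: "operator_system n R" and T: "operator_system m T"
  shows "sep_cone n R m T \<subseteq> sep_dual_cone n R m T"
proof
  fix x assume "x \<in> sep_cone n R m T"
  then obtain k a b where x: "x = tensor_sum n m k a b"
    and ab: "\<And>j. j < k \<Longrightarrow> a j \<in> pos_cone n R \<and> b j \<in> pos_cone m T"
    by (auto simp: sep_cone_def)
  have mem: "a j \<in> R \<and> b j \<in> T" and psd: "psd n (a j) \<and> psd m (b j)" if "j < k" for j
    using ab[OF that] by (auto simp: pos_cone_def)
  have car: "a j \<in> carrier_mat n n \<and> b j \<in> carrier_mat m m" if "j < k" for j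
    using psd[OF that] by (auto simp: psd_def)
  have xc: "x \<in> carrier_mat (n * m) (n * m)" unfolding x by (rule tensor_sum_carrier) (rule car)
  have "mat_adjoint x = x"
  proof (rule eq_matI)
    fix p q assume "p < dim_row x" "q < dim_col x"
    then have pq: "p < n * m" "q < n * m" using xc by auto
    then have "0 < m" by (cases m) auto
    then have "p div m < n" "q div m < n" "p mod m < m" "q mod m < m"
      using pq by (auto simp: less_mult_imp_div_less)
    then have "cnj (a j $$ (q div m, p div m)) = a j $$ (p div m, q div m)"
      "cnj (b j $$ (q mod m, p mod m)) = b j $$ (p mod m, q mod m)" if "j < k" for j
      using psd[OF that] psd_hermitian by metis+
    then show "mat_adjoint x $$ (p, q) = x $$ (p, q)"
      using pq by (simp add: mat_adjoint_index[OF xc]) (simp add: x tensor_sum_index[OF car])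
  qed (use xc mat_adjoint_carrier[OF xc] in auto)
  moreover have "0 \<le> tensor_functional n R m T \<phi> \<psi> x"
    if "positive_functional n R \<phi>" "positive_functional m T \<psi>" for \<phi> \<psi>
  proof -
    have "tensor_functional n R m T \<phi> \<psi> x = (\<Sum>j<k. \<phi> (a j) * \<psi> (b j))"
      unfolding x using that mem
      by (intro tensor_functional_eq[OF R T]) (auto simp: positive_functional_def)
    also have "0 \<le> \<dots>"
      using that ab by (intro sum_nonneg mult_nonneg_nonneg) (auto simp: positive_functional_def)
    finally show ?thesis .
  qed
  moreover have "x \<in> tensor_space n R m T"
    using mem unfolding x tensor_space_def by blast
  ultimately show "x \<in> sep_dual_cone n R m T" by (simp add: sep_dual_cone_def)
qed

section \<open>Fourier analysis of circulant matrices\<close>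

definition character :: "nat \<Rightarrow> int \<Rightarrow> complex" where
  "character m k = cis (2 * pi * of_int k / of_nat m)"

lemma character_add: "character m (k + l) = character m k * character m l"
  by (simp add: character_def cis_mult add_divide_distrib distrib_left)

lemma character_minus: "character m (- k) = cnj (character m k)"
  by (simp add: character_def cis_cnj)

lemma character_power: "character m (int l * k) = character m k ^ l"
  by (simp add: character_def DeMoivre mult_ac)

lemma character_eq_1_iff:
  assumes "m > 0"
  shows "character m k = 1 \<longleftrightarrow> int m dvd k"
proof
  assume "character m k = 1"
  \<comment> \<open>The real part suffices: a cosine equal to 1 already forces the angle to be a
    multiple of 2 pi.\<close>
  then have "cos (2 * pi * of_int k / of_nat m) = 1" by (simp add: character_def complex_eq_iff)
  then obtain z :: int where "2 * pi * of_int k / of_nat m = of_int z * 2 * pi"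
    by (auto simp: cos_one_2pi_int)
  then have "real_of_int k = of_int (z * int m)" using assms by (simp add: field_simps)
  then have "k = z * int m" by (simp only: of_int_eq_iff)
  then show "int m dvd k" by simp
next
  assume "int m dvd k"
  then obtain z where "k = int m * z" by (auto simp: dvd_def)
  then have "2 * pi * of_int k / of_nat m = 2 * pi * of_int z" using assms by simp
  then have "character m k = cis (2 * pi * of_int z)" by (simp only: character_def)
  also have "\<dots> = 1" by (rule cis_multiple_2pi) simp
  finally show "character m k = 1" .
qed

lemma character_mod: "m > 0 \<Longrightarrow> character m (k mod int m) = character m k"
  using character_add[of m "k mod int m" "int m * (k div int m)"] character_eq_1_iff[of m]
  by simp

text \<open>Orthogonality of characters: a geometric sum whose ratio is an m-th root of unity, so it
  vanishes unless the ratio is 1.\<close>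

lemma sum_character:
  assumes "m > 0"
  shows "(\<Sum>l<m. character m (int l * k)) = (if int m dvd k then of_nat m else 0)"
proof (cases "int m dvd k")
  case True
  then have "character m k = 1" using assms by (simp add: character_eq_1_iff)
  then show ?thesis using True by (simp add: character_power)
next
  case False
  then have ne: "character m k \<noteq> 1" using assms by (simp add: character_eq_1_iff)
  have "character m k ^ m = 1"
    using character_power[of m m k] character_eq_1_iff[OF assms, of "int m * k"] by simp
  then show ?thesis using False ne by (simp add: character_power sum_gp_strict)
qed

text \<open>Left unnormalised, with squared norm \<open>m\<close>; this is why
  \<open>fourier_proj\<close> and \<open>fourier_coeff\<close> each divide by
  \<open>m\<close>.\<close>

definition fourier_vec :: "nat \<Rightarrow> nat \<Rightarrow> complex vec" where
  "fourier_vec m l = vec m (\<lambda>j. character m (int l * int j))"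

definition fourier_proj :: "nat \<Rightarrow> nat \<Rightarrow> complex mat" where
  "fourier_proj m l = mat m m (\<lambda>(i, j). character m (int l * (int i - int j)) / of_nat m)"

text \<open>A Rayleigh quotient. For circulant \<open>B\<close> the vector
  \<open>fourier_vec m l\<close> is an eigenvector, so this is its eigenvalue; as a vector state it
  is also visibly positive.\<close>

definition fourier_coeff :: "nat \<Rightarrow> nat \<Rightarrow> complex mat \<Rightarrow> complex" where
  "fourier_coeff m l B = vector_functional (fourier_vec m l) B / of_nat m"

lemma fourier_proj_circulant:
  assumes "m > 0"
  shows "fourier_proj m l \<in> circulant_system m"
proof -
  have "character m (int l * (k mod int m)) = character m (int l * k)" for k
    by (simp add: character_power character_mod assms)
  then show ?thesis
    by (auto simp: fourier_proj_def circulant_system_def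
        intro!: exI[of _ "\<lambda>k. character m (int l * k) / of_nat m"])
qed

lemma psd_fourier_proj: "psd m (fourier_proj m l)"
proof (rule psdI)
  fix v :: "complex vec" assume v: "v \<in> carrier_vec m"
  \<comment> \<open>\<open>z\<close> is the inner product of \<open>v\<close> with
    \<open>fourier_vec m l\<close>; the projection has rank one, so its quadratic form is the
    squared modulus of \<open>z\<close> over \<open>m\<close>.\<close>
  define z where "z = (\<Sum>j<m. cnj (character m (int l * int j)) * v $ j)"
  have "vector_functional v (fourier_proj m l)
      = (\<Sum>i<m. \<Sum>j<m. character m (int l * int i) * cnj (v $ i)
          * (cnj (character m (int l * int j)) * v $ j)) / of_nat m"
    using v by (simp add: vector_functional_sum[of _ m] fourier_proj_def right_diff_distrib
        character_add[of m _ "- _", simplified] character_minus sum_divide_distrib mult_ac)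
  also have "\<dots> = cnj z * z / of_nat m"
    by (simp add: z_def sum_product)
  also have "\<dots> = of_real ((cmod z)\<^sup>2 / of_nat m)"
    using complex_norm_square[of z] by (simp add: mult.commute)
  also have "0 \<le> \<dots>" by (simp add: less_eq_complex_def)
  finally show "0 \<le> vector_functional v (fourier_proj m l)" .
qed (simp add: fourier_proj_def)

lemma positive_fourier_coeff:
  assumes "T \<subseteq> carrier_mat m m"
  shows "positive_functional m T (fourier_coeff m l)"
proof -
  have "positive_functional m T (vector_functional (fourier_vec m l))"
    by (rule positive_vector_functional[OF assms]) (simp add: fourier_vec_def)
  then show ?thesis
    by (auto simp: positive_functional_def linear_functional_def fourier_coeff_def
        add_divide_distrib less_eq_complex_def)
qed

text \<open>Summing over the frequency \<open>l\<close> first leaves only the entries of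
  \<open>B\<close> on the cyclic diagonal through (i, j). All of these equal the (i, j) entry; there
  is one in each of the \<open>m\<close> rows, weighted by \<open>m\<close>, which cancels the two
  normalisations.\<close>

lemma circulant_fourier_expansion:
  assumes m: "m > 0" and B: "B \<in> circulant_system m" and ij: "i < m" "j < m"
  shows "B $$ (i, j) = (\<Sum>l<m. fourier_coeff m l B * fourier_proj m l $$ (i, j))"
proof -
  obtain c where Bc: "B \<in> carrier_mat m m"
    and c: "\<And>r s. r < m \<Longrightarrow> s < m \<Longrightarrow> B $$ (r, s) = c ((int r - int s) mod int m)"
    using B by (auto simp: circulant_system_def)
  let ?k = "\<lambda>r s. (int s - int r) + (int i - int j)"
  have inner: "(\<Sum>s<m. B $$ (r, s) * (if int m dvd ?k r s then of_nat m else 0)) = of_nat m * B $$ (i, j)"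
    if r: "r < m" for r
  proof -
    \<comment> \<open>\<open>t\<close> is the only column in which row \<open>r\<close> meets the
      cyclic diagonal through (i, j).\<close>
    define t where "t = nat ((int r + int j - int i) mod int m)"
    have t: "t < m" "int t = (int r + int j - int i) mod int m"
      using m by (auto simp: t_def nat_less_iff)
    have dvd: "int m dvd ?k r s \<longleftrightarrow> s = t" if "s < m" for s
    proof -
      have "int m dvd ?k r s \<longleftrightarrow> int s mod int m = (int r + int j - int i) mod int m"
        by (simp add: mod_eq_dvd_iff algebra_simps)
      also have "\<dots> \<longleftrightarrow> s = t" using that by (simp flip: t(2))
      finally show ?thesis .
    qed
    have "(\<Sum>s<m. B $$ (r, s) * (if int m dvd ?k r s then of_nat m else 0))
        = (\<Sum>s<m. if s = t then of_nat m * B $$ (r, s) else 0)"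
      using dvd by (intro sum.cong) auto
    also have "\<dots> = of_nat m * B $$ (r, t)" using t by simp
    also have "B $$ (r, t) = B $$ (i, j)"
    proof -
      have "int m dvd ?k r t" using dvd[OF t(1)] by blast
      then have "(int r - int t) mod int m = (int i - int j) mod int m"
        unfolding mod_eq_dvd_iff by (subst dvd_minus_iff[symmetric]) (simp add: algebra_simps)
      then show ?thesis using c r t ij by simp
    qed
    finally show ?thesis .
  qed
  have summand: "fourier_coeff m l B * fourier_proj m l $$ (i, j)
      = (\<Sum>r<m. \<Sum>s<m. B $$ (r, s) * character m (int l * ?k r s)) / (of_nat m * of_nat m)" for l
  proof -
    have ch: "character m (int l * ?k r s) = character m (int l * int s)
        * cnj (character m (int l * int r)) * character m (int l * (int i - int j))" for r s
      by (simp add: character_minus[symmetric] character_add[symmetric] algebra_simps)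
    have "vector_functional (fourier_vec m l) B
        = (\<Sum>r<m. \<Sum>s<m. B $$ (r, s) * character m (int l * int s) * cnj (character m (int l * int r)))"
      using Bc by (simp add: vector_functional_sum[of _ m] fourier_vec_def)
    then show ?thesis
      unfolding ch using ij
      by (simp add: fourier_coeff_def fourier_proj_def sum_distrib_right mult.assoc)
  qed
  have "(\<Sum>l<m. fourier_coeff m l B * fourier_proj m l $$ (i, j))
      = (\<Sum>l<m. \<Sum>r<m. \<Sum>s<m. B $$ (r, s) * character m (int l * ?k r s)) / (of_nat m * of_nat m)"
    by (simp add: summand sum_divide_distrib)
  \<comment> \<open>Two exchanges move the sum over \<open>l\<close> innermost, where
    \<open>sum_character\<close> applies.\<close>
  also have "(\<Sum>l<m. \<Sum>r<m. \<Sum>s<m. B $$ (r, s) * character m (int l * ?k r s))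
      = (\<Sum>r<m. \<Sum>l<m. \<Sum>s<m. B $$ (r, s) * character m (int l * ?k r s))"
    by (rule sum.swap)
  also have "\<dots> = (\<Sum>r<m. \<Sum>s<m. \<Sum>l<m. B $$ (r, s) * character m (int l * ?k r s))"
    by (intro sum.cong sum.swap refl)
  also have "\<dots> = (\<Sum>r<m. \<Sum>s<m. B $$ (r, s) * (if int m dvd ?k r s then of_nat m else 0))"
    by (simp only: sum_distrib_left[symmetric] sum_character[OF m])
  also have "\<dots> = of_nat m * of_nat m * B $$ (i, j)" using inner by simp
  finally show ?thesis using m by simp
qed

section \<open>Equality of the two cones\<close>

text \<open>The first factor may be any operator system, because the decomposition is built from the
  Fourier projections of the second.\<close>

lemma sep_dual_cone_circulant_subset:
  assumes R: "operator_system n R" and m: "m > 0"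
  shows "sep_dual_cone n R m (circulant_system m) \<subseteq> sep_cone n R m (circulant_system m)"
proof
  let ?T = "circulant_system m"
  have Rc: "R \<subseteq> carrier_mat n n" and Tc: "?T \<subseteq> carrier_mat m m"
    using R operator_system_circulant[of m] by (auto simp: operator_system_def)
  fix x assume x_dual: "x \<in> sep_dual_cone n R m ?T"
  then obtain k a b where x: "x = tensor_sum n m k a b" and ab: "\<And>j. j < k \<Longrightarrow> a j \<in> R \<and> b j \<in> ?T"
    by (auto simp: sep_dual_cone_def tensor_space_def)
  have car: "a j \<in> carrier_mat n n \<and> b j \<in> carrier_mat m m" if "j < k" for j
    using ab[OF that] Rc Tc by auto
  \<comment> \<open>\<open>A l\<close> is the slice of \<open>x\<close> obtained by applying the
    identity to the first factor and \<open>fourier_coeff m l\<close> to the second.\<close>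
  define A where "A l = mat n n (\<lambda>pq. \<Sum>j<k. fourier_coeff m l (b j) * a j $$ pq)" for l
  have A: "A l \<in> pos_cone n R" for l
  proof -
    have lin: "linear_functional R (vector_functional v)" if "v \<in> carrier_vec n" for v
      by (rule linear_vector_functional[OF Rc that])
    \<comment> \<open>\<open>functional_sum\<close> yields membership together with a functional's
      value; the zero vector merely provides some linear functional to instantiate it.\<close>
    have "A l \<in> R"
      unfolding A_def using functional_sum[OF R lin[OF zero_carrier_vec], of k a "\<lambda>j. fourier_coeff m l (b j)"] ab
      by blast
    moreover have "psd n (A l)"
    proof (rule psdI)
      fix v :: "complex vec" assume v: "v \<in> carrier_vec n"
      have pos: "positive_functional n R (vector_functional v)"
        "positive_functional m ?T (fourier_coeff m l)"
        using positive_vector_functional[OF Rc v] positive_fourier_coeff[OF Tc] by auto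
      have "vector_functional v (A l) = (\<Sum>j<k. fourier_coeff m l (b j) * vector_functional v (a j))"
        unfolding A_def using functional_sum[OF R lin[OF v], of k a "\<lambda>j. fourier_coeff m l (b j)"] ab
      by blast
      also have "\<dots> = tensor_functional n R m ?T (vector_functional v) (fourier_coeff m l) x"
        unfolding x using pos ab
        by (subst tensor_functional_eq[OF R operator_system_circulant])
          (auto simp: positive_functional_def mult.commute)
      also have "0 \<le> \<dots>" using x_dual pos by (simp add: sep_dual_cone_def)
      finally show "0 \<le> vector_functional v (A l)" .
    qed (simp add: A_def)
    ultimately show ?thesis by (simp add: pos_cone_def)
  qed
  have P: "fourier_proj m l \<in> pos_cone m ?T" for l
    using fourier_proj_circulant[OF m] psd_fourier_proj by (simp add: pos_cone_def)
  have car': "A l \<in> carrier_mat n n \<and> fourier_proj m l \<in> carrier_mat m m" for l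
    by (simp add: A_def fourier_proj_def)
  have y: "tensor_sum n m m A (fourier_proj m) \<in> carrier_mat (n * m) (n * m)"
    by (rule tensor_sum_carrier) (rule car')
  have x_car: "x \<in> carrier_mat (n * m) (n * m)"
    unfolding x by (rule tensor_sum_carrier) (rule car)
  \<comment> \<open>Entrywise: expand every \<open>b j\<close> in the projections, then exchange the
    sums over \<open>j\<close> and \<open>l\<close> to collect the slices
    \<open>A l\<close>.\<close>
  have "x = tensor_sum n m m A (fourier_proj m)"
  proof (rule eq_matI)
    fix p q assume "p < dim_row (tensor_sum n m m A (fourier_proj m))"
      "q < dim_col (tensor_sum n m m A (fourier_proj m))"
    then have pq: "p < n * m" "q < n * m" using y by auto
    have idx: "p div m < n" "q div m < n" "p mod m < m" "q mod m < m"
      using pq m by (auto simp: less_mult_imp_div_less)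
    let ?P = "\<lambda>l. fourier_proj m l $$ (p mod m, q mod m)"
    have "x $$ (p, q) = (\<Sum>j<k. a j $$ (p div m, q div m) * b j $$ (p mod m, q mod m))"
      unfolding x by (rule tensor_sum_index[OF car pq])
    also have "\<dots> = (\<Sum>j<k. \<Sum>l<m. a j $$ (p div m, q div m) * (fourier_coeff m l (b j) * ?P l))"
      using circulant_fourier_expansion[OF m _ idx(3,4)] ab
      by (intro sum.cong refl) (auto simp flip: sum_distrib_left)
    also have "\<dots> = (\<Sum>l<m. \<Sum>j<k. a j $$ (p div m, q div m) * (fourier_coeff m l (b j) * ?P l))"
      by (rule sum.swap)
    also have "\<dots> = (\<Sum>l<m. A l $$ (p div m, q div m) * ?P l)"
      using idx by (simp add: A_def sum_distrib_left sum_distrib_right mult_ac)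
    also have "\<dots> = tensor_sum n m m A (fourier_proj m) $$ (p, q)"
      by (rule tensor_sum_index[OF car' pq, symmetric])
    finally show "x $$ (p, q) = tensor_sum n m m A (fourier_proj m) $$ (p, q)" .
  qed (use y x_car in auto)
  then show "x \<in> sep_cone n R m ?T" using A P unfolding sep_cone_def by blast
qed

theorem theorem1p8:
  fixes m n :: nat
  assumes "m > 0" and "n \<ge> 2"
  shows "sep_cone n (toeplitz_system n) m (circulant_system m)
       = sep_dual_cone n (toeplitz_system n) m (circulant_system m)"
  using sep_cone_subset_sep_dual_cone[OF operator_system_toeplitz operator_system_circulant]
    sep_dual_cone_circulant_subset[OF operator_system_toeplitz assms(1)]
  by (rule equalityI)

end
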